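(* Let $c_1,c_2,c_3>0$, let $(\phi_1,\phi_2,\phi_3)$ be a real-valued stationary solution, i.e. $-c_j^2\phi_j''+\sin(\phi_j)=0$ on $E_j$ for $j=1,2,3$, and let $\mathcal L=\left(\left(-c_j^2\frac{d^2}{dx^2}+\cos(\phi_j)\right)\delta_{j,k}\right)_{1\le j,k\le3}$ act on a domain $D(\mathcal L)\subset L^2(\mathcal Y)$ with $(\phi_1,\phi_2,\phi_3)\in D(\mathcal L)$. Let $$J=\begin{pmatrix}0&I_3\\-I_3&0\end{pmatrix},\qquad \mathcal E=\begin{pmatrix}\mathcal L&0\\0&I_3\end{pmatrix}.$$ Suppose that: (S1) $J\mathcal E$ is the generator of a $C_0$-semigroup $\{S(t)\}_{t\ge0}$; (S2) $\mathcal L$ is self-adjoint on $D(\mathcal L)\subset L^2(\mathcal Y)$; (S3) $\mathcal L:D(\mathcal L)\to L^2(\mathcal Y)$ is invertible with Morse index $n(\mathcal L)=1$, and $\sigma(\mathcal L)=\{\lambda_0\}\cup J_0$ with $\lambda_0<0$ and $J_0\subset[r_0,+\infty)$ for some $r_0>0$. Then the operator $J\mathcal E$ has a real positive and a real negative eigenvalue.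
   Context: $\mathcal Y$ is a $\mathcal Y$-junction: three half-line edges joined at the vertex $\nu=0$, either $E_1=(-\infty,0)$, $E_2=E_3=(0,\infty)$ (type I) or $E_1=E_2=E_3=(0,\infty)$ (type II). $L^2(\mathcal Y)$ and $H^m(\mathcal Y)$ are the direct sums of the corresponding spaces on the edges. $\delta_{j,k}$ is the Kronecker symbol and $I_3$ the $3\times3$ identity. The Morse index $n(\mathcal L)$ is the number of negative eigenvalues of $\mathcal L$ counted with multiplicity. Explicitly, $J\mathcal E(\mathbf u,\mathbf v)=(\mathbf v,-\mathcal L\mathbf u)$; this is the linearization of the first-order sine-Gordon system $\partial_tu_j=v_j$, $\partial_tv_j=c_j^2\partial_x^2u_j-\sin u_j$ around the stationary solution $(\phi_1,\phi_2,\phi_3,0,0,0)$. The semigroup in (S1) is considered on $H^1(\mathcal Y)\times L^2(\mathcal Y)$. An eigenvalue of $J\mathcal E$ is a number $\lambda$ for which there is a nonzero $\Psi\in D(\mathcal E)$ with $J\mathcal E\Psi=\lambda\Psi$. *)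

theory Defs
  imports "HOL-Analysis.Analysis" "HOL-Library.Extended_Nat"
begin

section \<open>Complex vector spaces\<close>

class complex_vector = real_vector +
  fixes scaleC :: "complex \<Rightarrow> 'a \<Rightarrow> 'a" (infixr \<open>*\<^sub>C\<close> 75)
  assumes scaleC_add_right: "a *\<^sub>C (x + y) = a *\<^sub>C x + a *\<^sub>C y"
    and scaleC_add_left: "(a + b) *\<^sub>C x = a *\<^sub>C x + b *\<^sub>C x"
    and scaleC_scaleC: "a *\<^sub>C b *\<^sub>C x = (a * b) *\<^sub>C x"
    and scaleC_one: "1 *\<^sub>C x = x"
    and scaleC_of_real: "of_real r *\<^sub>C x = r *\<^sub>R x"

global_interpretation complex_vector: vector_space "scaleC :: complex \<Rightarrow> 'a \<Rightarrow> 'a::complex_vector"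
  defines cdependent = complex_vector.dependent
    and csubspace = complex_vector.subspace
  by unfold_locales (rule scaleC_add_right scaleC_add_left scaleC_scaleC scaleC_one)+

instantiation vec :: (complex_vector, finite) complex_vector
begin

definition scaleC_vec_def: "a *\<^sub>C (u :: 'a ^ 'b) = (\<chi> i. a *\<^sub>C (u $ i))"

instance
  by standard (simp_all add: scaleC_vec_def vec_eq_iff scaleC_add_right scaleC_add_left
      scaleC_scaleC scaleC_one scaleC_of_real)

end

instantiation prod :: (complex_vector, complex_vector) complex_vector
begin

definition scaleC_prod_def: "a *\<^sub>C (w :: 'a \<times> 'b) = (a *\<^sub>C fst w, a *\<^sub>C snd w)"

instance
  by standard (simp_all add: scaleC_prod_def prod_eq_iff scaleC_add_right scaleC_add_left
      scaleC_scaleC scaleC_one scaleC_of_real)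

end


section \<open>The space $L^2(\mathbb R;\mathbb C)$\<close>

definition square_integrable :: "(real \<Rightarrow> complex) \<Rightarrow> bool" where
  "square_integrable f \<longleftrightarrow>
     f \<in> borel_measurable lborel \<and> integrable lborel (\<lambda>x. (cmod (f x))\<^sup>2)"

definition l2_eq :: "(real \<Rightarrow> complex) \<Rightarrow> (real \<Rightarrow> complex) \<Rightarrow> bool" where
  "l2_eq f g \<longleftrightarrow> square_integrable f \<and> square_integrable g \<and> (AE x in lborel. f x = g x)"

lemma square_integrable_zero: "square_integrable (\<lambda>_. 0)"
  by (simp add: square_integrable_def)

lemma square_integrable_add:
  assumes "square_integrable f" "square_integrable g"
  shows "square_integrable (\<lambda>x. f x + g x)"
  unfolding square_integrable_def
proof
  show m: "(\<lambda>x. f x + g x) \<in> borel_measurable lborel"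
    using assms by (auto simp: square_integrable_def)
  have "integrable lborel (\<lambda>x. 2 * (cmod (f x))\<^sup>2 + 2 * (cmod (g x))\<^sup>2)"
    using assms by (auto simp: square_integrable_def)
  then show "integrable lborel (\<lambda>x. (cmod (f x + g x))\<^sup>2)"
  proof (rule Bochner_Integration.integrable_bound)
    show "(\<lambda>x. (cmod (f x + g x))\<^sup>2) \<in> borel_measurable lborel"
      using m by measurable
    have "(cmod (a + b))\<^sup>2 \<le> 2 * (cmod a)\<^sup>2 + 2 * (cmod b)\<^sup>2" for a b :: complex
    proof -
      have "(cmod (a + b))\<^sup>2 \<le> (cmod a + cmod b)\<^sup>2"
        by (intro power_mono norm_triangle_ineq) auto
      also have "\<dots> \<le> 2 * (cmod a)\<^sup>2 + 2 * (cmod b)\<^sup>2"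
        using sum_squares_bound[of "cmod a" "cmod b"] by (simp add: power2_sum)
      finally show ?thesis .
    qed
    then show "AE x in lborel. norm ((cmod (f x + g x))\<^sup>2)
        \<le> norm (2 * (cmod (f x))\<^sup>2 + 2 * (cmod (g x))\<^sup>2)"
      by (auto intro!: AE_I2 order_trans[OF _ abs_ge_self])
  qed
qed

lemma square_integrable_scale:
  "square_integrable f \<Longrightarrow> square_integrable (\<lambda>x. c * f x)"
  by (auto simp: square_integrable_def norm_mult power_mult_distrib)

lemma integrable_mult_cnj:
  assumes "square_integrable f" "square_integrable g"
  shows "integrable lborel (\<lambda>x. f x * cnj (g x))"
proof (rule Bochner_Integration.integrable_bound)
  show "integrable lborel (\<lambda>x. (cmod (f x))\<^sup>2 + (cmod (g x))\<^sup>2)"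
    using assms by (auto simp: square_integrable_def)
  have "cnj \<in> borel_measurable borel"
    by (intro borel_measurable_continuous_onI continuous_intros)
  then show "(\<lambda>x. f x * cnj (g x)) \<in> borel_measurable lborel"
    using assms by (auto simp: square_integrable_def intro!: borel_measurable_times)
  have "cmod a * cmod b \<le> (cmod a)\<^sup>2 + (cmod b)\<^sup>2" for a b
    using sum_squares_bound[of "cmod a" "cmod b"] mult_nonneg_nonneg[of "cmod a" "cmod b"]
    by (simp add: algebra_simps del: mult_nonneg_nonneg)
  then show "AE x in lborel. norm (f x * cnj (g x)) \<le> norm ((cmod (f x))\<^sup>2 + (cmod (g x))\<^sup>2)"
    by (auto simp: norm_mult intro!: AE_I2 order_trans[OF _ abs_ge_self])
qed

quotient_type l2 = "real \<Rightarrow> complex" / partial: l2_eq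
proof (rule part_equivpI)
  show "\<exists>x. l2_eq x x"
    using square_integrable_zero by (auto simp: l2_eq_def)
  show "symp l2_eq"
    by (auto simp: symp_def l2_eq_def elim!: AE_mp)
  show "transp l2_eq"
  proof (rule transpI)
    fix f g h assume "l2_eq f g" "l2_eq g h"
    moreover have "AE x in lborel. f x = h x"
      if "AE x in lborel. f x = g x" "AE x in lborel. g x = h x"
      using that by eventually_elim simp
    ultimately show "l2_eq f h" by (auto simp: l2_eq_def)
  qed
qed

instantiation l2 :: complex_vector
begin

lift_definition zero_l2 :: l2 is "\<lambda>_. 0"
  by (simp add: l2_eq_def square_integrable_zero)

lift_definition scaleC_l2 :: "complex \<Rightarrow> l2 \<Rightarrow> l2" is "\<lambda>c f x. c * f x"
  by (auto simp: l2_eq_def square_integrable_scale elim!: AE_mp)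

lift_definition scaleR_l2 :: "real \<Rightarrow> l2 \<Rightarrow> l2" is "\<lambda>r f x. of_real r * f x"
  by (auto simp: l2_eq_def square_integrable_scale elim!: AE_mp)

lift_definition uminus_l2 :: "l2 \<Rightarrow> l2" is "\<lambda>f x. (-1) * f x"
  unfolding l2_eq_def by (intro conjI square_integrable_scale) (auto elim!: AE_mp)

lift_definition plus_l2 :: "l2 \<Rightarrow> l2 \<Rightarrow> l2" is "\<lambda>f g x. f x + g x"
  unfolding l2_eq_def by (intro conjI square_integrable_add) (auto elim!: AE_mp)

definition minus_l2 :: "l2 \<Rightarrow> l2 \<Rightarrow> l2" where "minus_l2 f g = f + - g"

instance
proof
  fix a b c :: l2 and r s :: real and y z :: complex
  show "a + b + c = a + (b + c)" by transfer (auto simp: l2_eq_def add.assoc square_integrable_add)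
  show "a + b = b + a" by transfer (auto simp: l2_eq_def add.commute square_integrable_add)
  show "0 + a = a" by transfer (auto simp: l2_eq_def)
  show "- a + a = 0"
    by transfer (use square_integrable_scale[of _ "-1"] in
        \<open>auto simp: l2_eq_def square_integrable_zero\<close>)
  show "a - b = a + - b" by (simp add: minus_l2_def)
  show "r *\<^sub>R (a + b) = r *\<^sub>R a + r *\<^sub>R b"
    by transfer (auto simp: l2_eq_def distrib_left square_integrable_add square_integrable_scale)
  show "(r + s) *\<^sub>R a = r *\<^sub>R a + s *\<^sub>R a"
    by transfer (auto simp: l2_eq_def distrib_right square_integrable_add square_integrable_scale)
  show "r *\<^sub>R s *\<^sub>R a = (r * s) *\<^sub>R a"
    by transfer (auto simp: l2_eq_def mult.assoc square_integrable_scale)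
  show "1 *\<^sub>R a = a" by transfer (auto simp: l2_eq_def)
  show "y *\<^sub>C (a + b) = y *\<^sub>C a + y *\<^sub>C b"
    by transfer (auto simp: l2_eq_def distrib_left square_integrable_add square_integrable_scale)
  show "(y + z) *\<^sub>C a = y *\<^sub>C a + z *\<^sub>C a"
    by transfer (auto simp: l2_eq_def distrib_right square_integrable_add square_integrable_scale)
  show "y *\<^sub>C z *\<^sub>C a = (y * z) *\<^sub>C a"
    by transfer (auto simp: l2_eq_def mult.assoc square_integrable_scale)
  show "1 *\<^sub>C a = a" by transfer (auto simp: l2_eq_def)
  show "of_real r *\<^sub>C a = r *\<^sub>R a" by transfer (auto simp: l2_eq_def square_integrable_scale)
qed

end

lift_definition cinner_l2 :: "l2 \<Rightarrow> l2 \<Rightarrow> complex" is "\<lambda>f g. LINT x|lborel. f x * cnj (g x)"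
  by (intro integral_cong_AE borel_measurable_integrable[OF integrable_mult_cnj])
     (auto simp: l2_eq_def elim!: AE_mp)

instantiation l2 :: real_inner
begin

definition inner_l2 :: "l2 \<Rightarrow> l2 \<Rightarrow> real" where "inner_l2 f g = Re (cinner_l2 f g)"
definition norm_l2 :: "l2 \<Rightarrow> real" where "norm_l2 f = sqrt (inner f f)"
definition sgn_l2 :: "l2 \<Rightarrow> l2" where "sgn_l2 f = f /\<^sub>R norm f"
definition dist_l2 :: "l2 \<Rightarrow> l2 \<Rightarrow> real" where "dist_l2 f g = norm (f - g)"
definition uniformity_l2 :: "(l2 \<times> l2) filter" where
  "uniformity_l2 = (INF e\<in>{0<..}. principal {(x, y). dist x y < e})"
definition open_l2 :: "l2 set \<Rightarrow> bool" where
  "open_l2 U \<longleftrightarrow> (\<forall>x\<in>U. eventually (\<lambda>(x', y). x' = x \<longrightarrow> y \<in> U) uniformity)"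

instance
proof
  fix f g h :: l2 and r :: real
  have cnj: "cinner_l2 g f = cnj (cinner_l2 f g)"
    
  proof transfer
    fix F G :: "real \<Rightarrow> complex"
    have "cnj (LINT x|lborel. F x * cnj (G x)) = (LINT x|lborel. cnj (F x * cnj (G x)))"
      by (rule Bochner_Integration.integral_cnj[symmetric])
    then show "(LINT x|lborel. G x * cnj (F x)) = cnj (LINT x|lborel. F x * cnj (G x))"
      by (simp add: mult.commute)
  qed
  show "inner f g = inner g f"
    unfolding inner_l2_def by (subst cnj) simp
  have "cinner_l2 (f + g) h = cinner_l2 f h + cinner_l2 g h"
    by transfer (simp add: l2_eq_def distrib_right integrable_mult_cnj)
  then show "inner (f + g) h = inner f h + inner g h"
    by (simp add: inner_l2_def)
  have "cinner_l2 (r *\<^sub>R f) g = of_real r * cinner_l2 f g"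
    by transfer (simp add: l2_eq_def mult.assoc)
  then show "inner (r *\<^sub>R f) g = r * inner f g"
    by (simp add: inner_l2_def)
  have re: "Re (LINT x|lborel. F x * cnj (F x)) = (LINT x|lborel. (cmod (F x))\<^sup>2)" for F :: "real \<Rightarrow> complex"
    by (simp only: complex_norm_square[symmetric] integral_complex_of_real Re_complex_of_real)
  show "0 \<le> inner f f"
    unfolding inner_l2_def by transfer (simp only: re integral_nonneg_AE zero_le_power2 AE_I2)
  show "inner f f = 0 \<longleftrightarrow> f = 0"
    unfolding inner_l2_def
  proof transfer
    fix F assume "l2_eq F F"
    then show "(Re (LINT x|lborel. F x * cnj (F x)) = 0) = l2_eq F (\<lambda>_. 0)"
      unfolding re
      by (subst integral_nonneg_eq_0_iff_AE)
         (auto simp: l2_eq_def square_integrable_def)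
  qed
qed (simp_all add: norm_l2_def sgn_l2_def dist_l2_def uniformity_l2_def open_l2_def)

end


section \<open>Sobolev spaces on an open set of the line\<close>

text \<open>
  Functions on an edge \<open>E\<close> are extended by zero, so \<open>L\<^sup>2(E)\<close> is the set of elements of \<^typ>\<open>l2\<close>
  that vanish almost everywhere outside \<open>E\<close>. No derivative is ever taken across the boundary of \<open>E\<close>,
  since test functions are supported in a compact subset of \<open>E\<close>. The representative chosen by
  \<^const>\<open>rep_l2\<close> only enters through integrals and almost-everywhere statements.
\<close>

definition L2_on :: "real set \<Rightarrow> l2 set" where
  "L2_on E = {f. AE x in lborel. x \<notin> E \<longrightarrow> rep_l2 f x = 0}"

definition test_functions :: "real set \<Rightarrow> (real \<Rightarrow> real) set" where
  "test_functions E = {\<psi>. (\<forall>n x. (deriv ^^ n) \<psi> differentiable (at x)) \<and>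
     (\<exists>K. compact K \<and> K \<subseteq> E \<and> (\<forall>x. x \<notin> K \<longrightarrow> \<psi> x = 0))}"

definition has_weak_deriv_on :: "real set \<Rightarrow> l2 \<Rightarrow> l2 \<Rightarrow> bool" where
  "has_weak_deriv_on E f g \<longleftrightarrow> f \<in> L2_on E \<and> g \<in> L2_on E \<and>
     (\<forall>\<psi>\<in>test_functions E.
        (LINT x|lborel. rep_l2 f x * of_real (deriv \<psi> x)) =
        - (LINT x|lborel. rep_l2 g x * of_real (\<psi> x)))"

text \<open>The weak derivative, if it exists, is unique when \<open>E\<close> is open.\<close>
definition weak_deriv :: "real set \<Rightarrow> l2 \<Rightarrow> l2" where
  "weak_deriv E f = (THE g. has_weak_deriv_on E f g)"

primrec sobolev :: "nat \<Rightarrow> real set \<Rightarrow> l2 set" where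
  "sobolev 0 E = L2_on E"
| "sobolev (Suc m) E = {f \<in> L2_on E. \<exists>g\<in>sobolev m E. has_weak_deriv_on E f g}"

text \<open>Multiplication by a bounded measurable function \<open>p\<close>.\<close>
definition l2_mult :: "(real \<Rightarrow> real) \<Rightarrow> l2 \<Rightarrow> l2" where
  "l2_mult p f = abs_l2 (\<lambda>x. of_real (p x) * rep_l2 f x)"


section \<open>Operators and semigroups\<close>

text \<open>An operator is given by a domain \<open>D\<close> and a map \<open>A\<close>, whose values outside \<open>D\<close> are irrelevant.\<close>

definition eigenspace :: "'a set \<Rightarrow> ('a \<Rightarrow> 'a) \<Rightarrow> complex \<Rightarrow> 'a::complex_vector set" where
  "eigenspace D A z = {u \<in> D. A u = z *\<^sub>C u}"

definition is_eigenvalue :: "'a set \<Rightarrow> ('a \<Rightarrow> 'a::complex_vector) \<Rightarrow> complex \<Rightarrow> bool" where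
  "is_eigenvalue D A z \<longleftrightarrow> (\<exists>u\<in>D. u \<noteq> 0 \<and> A u = z *\<^sub>C u)"

definition multiplicity_of :: "'a set \<Rightarrow> ('a \<Rightarrow> 'a::complex_vector) \<Rightarrow> complex \<Rightarrow> enat" where
  "multiplicity_of D A z =
     (SUP B\<in>{B. finite B \<and> B \<subseteq> eigenspace D A z \<and> \<not> cdependent B}. enat (card B))"

text \<open>
  The sum of the multiplicities over all negative reals, as a supremum of finite partial sums;
  a number that is not an eigenvalue contributes zero.
\<close>
definition morse_index :: "'a set \<Rightarrow> ('a \<Rightarrow> 'a::complex_vector) \<Rightarrow> enat" where
  "morse_index D A =
     (SUP F\<in>{F :: real set. finite F \<and> F \<subseteq> {..<0}}. \<Sum>\<mu>\<in>F. multiplicity_of D A (of_real \<mu>))"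

definition invertible_operator ::
    "'a set \<Rightarrow> 'a set \<Rightarrow> ('a \<Rightarrow> 'a::real_normed_vector) \<Rightarrow> bool" where
  "invertible_operator H D A \<longleftrightarrow> bij_betw A D H \<and> (\<exists>C. \<forall>u\<in>D. norm u \<le> C * norm (A u))"

definition operator_spectrum ::
    "'a set \<Rightarrow> 'a set \<Rightarrow> ('a \<Rightarrow> 'a::{complex_vector, real_normed_vector}) \<Rightarrow> complex set" where
  "operator_spectrum H D A = {z. \<not> invertible_operator H D (\<lambda>u. A u - z *\<^sub>C u)}"

definition cinner_vec :: "l2 ^ 'n \<Rightarrow> l2 ^ 'n::finite \<Rightarrow> complex" where
  "cinner_vec u v = (\<Sum>j\<in>UNIV. cinner_l2 (u $ j) (v $ j))"

text \<open>Densely defined in \<open>H\<close> and equal to its adjoint, including equality of the domains.\<close>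
definition self_adjoint_operator ::
    "(l2 ^ 'n) set \<Rightarrow> (l2 ^ 'n) set \<Rightarrow> (l2 ^ 'n \<Rightarrow> l2 ^ 'n::finite) \<Rightarrow> bool" where
  "self_adjoint_operator H D A \<longleftrightarrow>
     csubspace D \<and> D \<subseteq> H \<and> H \<subseteq> closure D \<and> A ` D \<subseteq> H \<and>
     (\<forall>u\<in>D. \<forall>v\<in>D. cinner_vec (A u) v = cinner_vec u (A v)) \<and>
     D = {v \<in> H. \<exists>w\<in>H. \<forall>u\<in>D. cinner_vec (A u) v = cinner_vec u w}"

text \<open>\<open>X\<close> is a subspace, normed by \<open>N\<close> (which need not be the norm of the ambient type).\<close>
definition C0_semigroup ::
    "'a set \<Rightarrow> ('a \<Rightarrow> real) \<Rightarrow> (real \<Rightarrow> 'a \<Rightarrow> 'a::complex_vector) \<Rightarrow> bool" where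
  "C0_semigroup X N S \<longleftrightarrow>
     (\<forall>t\<ge>0. \<forall>w\<in>X. S t w \<in> X) \<and>
     (\<forall>t\<ge>0. \<forall>w\<in>X. \<forall>z\<in>X. S t (w + z) = S t w + S t z) \<and>
     (\<forall>t\<ge>0. \<forall>a. \<forall>w\<in>X. S t (a *\<^sub>C w) = a *\<^sub>C S t w) \<and>
     (\<forall>t\<ge>0. \<exists>C. \<forall>w\<in>X. N (S t w) \<le> C * N w) \<and>
     (\<forall>w\<in>X. S 0 w = w) \<and>
     (\<forall>s\<ge>0. \<forall>t\<ge>0. \<forall>w\<in>X. S (s + t) w = S s (S t w)) \<and>
     (\<forall>w\<in>X. ((\<lambda>t. N (S t w - w)) \<longlongrightarrow> 0) (at_right 0))"

definition is_generator ::
    "'a set \<Rightarrow> ('a \<Rightarrow> real) \<Rightarrow> (real \<Rightarrow> 'a \<Rightarrow> 'a) \<Rightarrow> 'a set \<Rightarrow> ('a \<Rightarrow> 'a::complex_vector) \<Rightarrow> bool" where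
  "is_generator X N S D A \<longleftrightarrow>
     D = {w \<in> X. \<exists>z\<in>X. ((\<lambda>t. N ((S t w - w) /\<^sub>R t - z)) \<longlongrightarrow> 0) (at_right 0)} \<and>
     (\<forall>w\<in>D. A w \<in> X \<and> ((\<lambda>t. N ((S t w - w) /\<^sub>R t - A w)) \<longlongrightarrow> 0) (at_right 0))"


section \<open>The sine-Gordon operator on a $\mathcal Y$-junction\<close>

datatype junction = TypeI | TypeII

fun edge :: "junction \<Rightarrow> 3 \<Rightarrow> real set" where
  "edge TypeI j = (if j = 1 then {..<0} else {0<..})"
| "edge TypeII j = {0<..}"

definition H_Y :: "nat \<Rightarrow> junction \<Rightarrow> (l2 ^ 3) set" where
  "H_Y m Y = {u. \<forall>j. u $ j \<in> sobolev m (edge Y j)}"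

abbreviation L2_Y :: "junction \<Rightarrow> (l2 ^ 3) set" where
  "L2_Y \<equiv> H_Y 0"

definition stationary_solution :: "junction \<Rightarrow> (3 \<Rightarrow> real) \<Rightarrow> (3 \<Rightarrow> real \<Rightarrow> real) \<Rightarrow> bool" where
  "stationary_solution Y c \<phi> \<longleftrightarrow> (\<forall>j. \<forall>x\<in>edge Y j.
     \<phi> j differentiable (at x) \<and> deriv (\<phi> j) differentiable (at x) \<and>
     - (c j)\<^sup>2 * deriv (deriv (\<phi> j)) x + sin (\<phi> j x) = 0)"

definition represents :: "junction \<Rightarrow> l2 ^ 3 \<Rightarrow> (3 \<Rightarrow> real \<Rightarrow> real) \<Rightarrow> bool" where
  "represents Y \<Phi> \<phi> \<longleftrightarrow>
     (\<forall>j. AE x in lborel. x \<in> edge Y j \<longrightarrow> rep_l2 (\<Phi> $ j) x = of_real (\<phi> j x))"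

definition L_op :: "junction \<Rightarrow> (3 \<Rightarrow> real) \<Rightarrow> (3 \<Rightarrow> real \<Rightarrow> real) \<Rightarrow> l2 ^ 3 \<Rightarrow> l2 ^ 3" where
  "L_op Y c \<phi> u = (\<chi> j.
     - (c j)\<^sup>2 *\<^sub>R weak_deriv (edge Y j) (weak_deriv (edge Y j) (u $ j))
     + l2_mult (\<lambda>x. indicator (edge Y j) x * cos (\<phi> j x)) (u $ j))"

definition J_op :: "(l2 ^ 3) \<times> (l2 ^ 3) \<Rightarrow> (l2 ^ 3) \<times> (l2 ^ 3)" where
  "J_op = (\<lambda>(u, v). (v, - u))"

definition E_op :: "(l2 ^ 3 \<Rightarrow> l2 ^ 3) \<Rightarrow> (l2 ^ 3) \<times> (l2 ^ 3) \<Rightarrow> (l2 ^ 3) \<times> (l2 ^ 3)" where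
  "E_op L = (\<lambda>(u, v). (L u, v))"

definition phase_space :: "junction \<Rightarrow> ((l2 ^ 3) \<times> (l2 ^ 3)) set" where
  "phase_space Y = H_Y 1 Y \<times> L2_Y Y"

definition phase_norm :: "junction \<Rightarrow> (l2 ^ 3) \<times> (l2 ^ 3) \<Rightarrow> real" where
  "phase_norm Y = (\<lambda>(u, v). sqrt (
     (\<Sum>j\<in>UNIV. (norm (u $ j))\<^sup>2 + (norm (weak_deriv (edge Y j) (u $ j)))\<^sup>2) + (norm v)\<^sup>2))"

text \<open>
  Domain of \<open>\<E>\<close> for operators acting in \<^const>\<open>phase_space\<close>: since \<open>J\<E>(u, v) = (v, -\<L>u)\<close> has to
  lie in \<open>H\<^sup>1 \<times> L\<^sup>2\<close>, the second component ranges over \<open>H\<^sup>1\<close>.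
\<close>
definition E_dom :: "junction \<Rightarrow> (l2 ^ 3) set \<Rightarrow> ((l2 ^ 3) \<times> (l2 ^ 3)) set" where
  "E_dom Y D = D \<times> H_Y 1 Y"

end

(*
  An eigenvector u of L for a negative eigenvalue m gives eigenvectors (u, l u) of JE for both
  square roots l of -m, because JE (u, v) = (v, -L u). A negative eigenvalue of L exists since its
  Morse index is not zero.
*)
theory Submission
  imports Defs
begin

text \<open>By induction: the weak derivative witnessing order \<open>Suc m\<close> itself lies one
  order lower. Used to pass from H^2, which contains \<open>DL\<close>, to the H^1 required of
  second components in \<open>E_dom\<close>.\<close>

lemma H_Y_Suc_subset: "H_Y (Suc m) Y \<subseteq> H_Y m Y"
proof -
  have "sobolev (Suc m) E \<subseteq> sobolev m E" for E
    by (induction m) (auto simp: has_weak_deriv_on_def)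
  then show ?thesis unfolding H_Y_def by blast
qed

text \<open>The eigenspace contains at most the zero vector, and a set containing 0 is dependent, so
  the supremum only ranges over the empty family.\<close>

lemma multiplicity_of_eq_0:
  assumes "\<not> is_eigenvalue D A z"
  shows "multiplicity_of D A z = 0"
proof -
  have "B = {}" if "B \<subseteq> eigenspace D A z" "\<not> cdependent B" for B
  proof -
    have "eigenspace D A z \<subseteq> {0}"
      using assms by (auto simp: is_eigenvalue_def eigenspace_def)
    then show "B = {}"
      using that complex_vector.dependent_zero[of B] by blast
  qed
  then have "multiplicity_of D A z \<le> 0"
    unfolding multiplicity_of_def
    by (intro SUP_least) (auto simp: zero_enat_def)
  then show ?thesis by simp
qed

text \<open>Otherwise every finite partial sum over negative reals would consist of zero
  multiplicities, and so would have supremum 0.\<close>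

lemma negative_eigenvalue_exists:
  assumes "morse_index D A \<noteq> 0"
  obtains \<mu> :: real where "\<mu> < 0" "is_eigenvalue D A (of_real \<mu>)"
proof -
  have "\<exists>\<mu><0. is_eigenvalue D A (of_real \<mu>)"
  proof (rule ccontr)
    assume "\<not> ?thesis"
    then have "morse_index D A \<le> 0"
      unfolding morse_index_def
      by (intro SUP_least) (auto simp: multiplicity_of_eq_0 subset_eq)
    with assms show False by simp
  qed
  then show thesis using that by blast
qed

lemma JE_eigenvalue:
  assumes "u \<in> DL" "u \<noteq> 0" "L u = of_real \<mu> *\<^sub>C u"
    and "of_real l *\<^sub>C u \<in> H_Y 1 Y" and "l\<^sup>2 = - \<mu>"
  shows "is_eigenvalue (E_dom Y DL) (J_op \<circ> E_op L) (of_real l)"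
  unfolding is_eigenvalue_def
\<comment> \<open>The first row of the eigenvalue equation forces v = l u; the second row then
  becomes -L u = l^2 u, which is where l^2 = -\<mu> enters.\<close>
proof (intro bexI[of _ "(u, of_real l *\<^sub>C u)"] conjI)
  have "\<mu> = - (l * l)"
    using assms(5) by (simp add: power2_eq_square)
  then show "(J_op \<circ> E_op L) (u, of_real l *\<^sub>C u) = of_real l *\<^sub>C (u, of_real l *\<^sub>C u)"
    using assms(3) by (simp add: J_op_def E_op_def scaleC_prod_def scaleC_scaleC)
qed (use assms in \<open>auto simp: E_dom_def prod_eq_iff\<close>)

theorem theorem3p2:
  fixes Y :: junction and c :: "3 \<Rightarrow> real" and \<phi> :: "3 \<Rightarrow> real \<Rightarrow> real"
    and DL :: "(l2 ^ 3) set" and \<Phi> :: "l2 ^ 3"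
    and S :: "real \<Rightarrow> (l2 ^ 3) \<times> (l2 ^ 3) \<Rightarrow> (l2 ^ 3) \<times> (l2 ^ 3)"
    and \<mu>0 r0 :: real and J0 :: "real set"
  defines "L \<equiv> L_op Y c \<phi>"
  assumes c_pos: "\<And>j. c j > 0"
    and stationary: "stationary_solution Y c \<phi>"
    and DL_sub: "DL \<subseteq> H_Y 2 Y"
    and phi_in: "\<Phi> \<in> DL" "represents Y \<Phi> \<phi>"
    and S1: "C0_semigroup (phase_space Y) (phase_norm Y) S"
            "is_generator (phase_space Y) (phase_norm Y) S (E_dom Y DL) (J_op \<circ> E_op L)"
    and S2: "self_adjoint_operator (L2_Y Y) DL L"
    and S3: "invertible_operator (L2_Y Y) DL L"
            "morse_index DL L = 1"
            "operator_spectrum (L2_Y Y) DL L = of_real ` ({\<mu>0} \<union> J0)"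
            "\<mu>0 < 0" "r0 > 0" "J0 \<subseteq> {r0..}"
  shows "(\<exists>\<mu>>0. is_eigenvalue (E_dom Y DL) (J_op \<circ> E_op L) (of_real \<mu>)) \<and>
         (\<exists>\<mu><0. is_eigenvalue (E_dom Y DL) (J_op \<circ> E_op L) (of_real \<mu>))"
proof -
  obtain \<mu> :: real where neg: "\<mu> < 0" and "is_eigenvalue DL L (of_real \<mu>)"
    using negative_eigenvalue_exists S3(2) by (metis zero_neq_one)
  then obtain u where u: "u \<in> DL" "u \<noteq> 0" "L u = of_real \<mu> *\<^sub>C u"
    by (auto simp: is_eigenvalue_def)
  \<comment> \<open>The sign of \<open>l\<close> is left open so that both square roots are covered
    at once.\<close>
  have eig: "is_eigenvalue (E_dom Y DL) (J_op \<circ> E_op L) (of_real l)" if "l\<^sup>2 = - \<mu>" for l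
  proof (rule JE_eigenvalue[of u DL L \<mu>, OF u])
    \<comment> \<open>Self-adjointness includes that \<open>DL\<close> is a complex subspace, so the
      multiple of \<open>u\<close> keeps the H^2 regularity.\<close>
    have "of_real l *\<^sub>C u \<in> DL"
      using S2 u(1) complex_vector.subspace_scale
      by (auto simp: self_adjoint_operator_def)
    then show "of_real l *\<^sub>C u \<in> H_Y 1 Y"
      using DL_sub H_Y_Suc_subset[of 1 Y] by (auto simp: numeral_2_eq_2)
  qed (rule that)
  have "is_eigenvalue (E_dom Y DL) (J_op \<circ> E_op L) (of_real (sqrt (- \<mu>)))"
    "is_eigenvalue (E_dom Y DL) (J_op \<circ> E_op L) (of_real (- sqrt (- \<mu>)))"
    using neg by (intro eig; simp)+
  moreover have "sqrt (- \<mu>) > 0" "- sqrt (- \<mu>) < 0"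
    using neg by auto
  ultimately show ?thesis by blast
qed

end
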